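(* Let $G_\sigma$ be a connected signed graph with no positive cycles and at least two vertices. Then: (a) $G_\sigma$ is sign connected if and only if it has a cycle. (b) If $G_\sigma$ has exactly one cycle, then every edge is a sign isthmus. (c) If $G_\sigma$ has at least two cycles, then an edge is a sign isthmus if and only if it is an isthmus.
   Context: A signed graph consists of a finite undirected graph, in which loops and multiple edges are allowed, with a sign $\pm1$ on each edge. Cycles are elementary; a loop is a cycle of length 1. Chains are walks. The sign of a cycle or chain is the product of its edge signs, counted with multiplicity. Vertices $x,y$ are sign connected if $x=y$ or both a positive and a negative chain join them. The signed graph is sign connected if every two vertices are sign connected. For a sign-connected $G_\sigma$, an edge $e$ is a sign isthmus if $G_\sigma-e$ is not sign connected. An isthmus is an edge whose deletion increases the number of connected components. *)

theory Defs
  imports Main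
begin

text \<open>Multigraphs with loops: edges are named, \<open>ends e\<close> is the set of endpoints of \<open>e\<close>
  (a singleton for a loop), and parallel edges have equal \<open>ends\<close>.\<close>

record ('v, 'e) pre_signed_graph =
  verts :: "'v set"
  edges :: "'e set"
  ends :: "'e \<Rightarrow> 'v set"
  esign :: "'e \<Rightarrow> int"

locale signed_graph =
  fixes G :: "('v, 'e) pre_signed_graph"
  assumes finite_verts: "finite (verts G)"
    and finite_edges: "finite (edges G)"
    and ends_verts: "e \<in> edges G \<Longrightarrow> \<exists>u\<in>verts G. \<exists>v\<in>verts G. ends G e = {u, v}"
    and esign_values: "e \<in> edges G \<Longrightarrow> esign G e = 1 \<or> esign G e = -1"

definition del_edge :: "('v, 'e) pre_signed_graph \<Rightarrow> 'e \<Rightarrow> ('v, 'e) pre_signed_graph" where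
  "del_edge G e = G\<lparr>edges := edges G - {e}\<rparr>"

text \<open>A chain from \<open>u\<close> is the list of its steps, each consisting of the edge traversed and the
  vertex it leads to; vertices and edges may repeat.\<close>

fun chain :: "('v, 'e) pre_signed_graph \<Rightarrow> 'v \<Rightarrow> ('e \<times> 'v) list \<Rightarrow> 'v \<Rightarrow> bool" where
  "chain G u [] v \<longleftrightarrow> u \<in> verts G \<and> u = v"
| "chain G u ((e, w) # p) v \<longleftrightarrow>
     u \<in> verts G \<and> e \<in> edges G \<and> ends G e = {u, w} \<and> chain G w p v"

definition chain_sign :: "('v, 'e) pre_signed_graph \<Rightarrow> ('e \<times> 'v) list \<Rightarrow> int" where
  "chain_sign G p = prod_list (map (\<lambda>(e, w). esign G e) p)"

text \<open>A cycle is identified with its edge set, so that the choice of starting point and direction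
  does not affect the number of cycles. Distinctness of the edges is only needed to prevent
  traversing a single non-loop edge back and forth from counting as a cycle of length 2.\<close>

definition cycles :: "('v, 'e) pre_signed_graph \<Rightarrow> 'e set set" where
  "cycles G = {fst ` set p | p. \<exists>u. chain G u p u \<and> p \<noteq> [] \<and>
                 distinct (map fst p) \<and> distinct (map snd p)}"

definition cycle_sign :: "('v, 'e) pre_signed_graph \<Rightarrow> 'e set \<Rightarrow> int" where
  "cycle_sign G C = (\<Prod>e\<in>C. esign G e)"

definition joined :: "('v, 'e) pre_signed_graph \<Rightarrow> 'v \<Rightarrow> 'v \<Rightarrow> bool" where
  "joined G x y \<longleftrightarrow> (\<exists>p. chain G x p y)"

definition connected_graph :: "('v, 'e) pre_signed_graph \<Rightarrow> bool" where
  "connected_graph G \<longleftrightarrow> verts G \<noteq> {} \<and> (\<forall>x\<in>verts G. \<forall>y\<in>verts G. joined G x y)"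

definition components :: "('v, 'e) pre_signed_graph \<Rightarrow> 'v set set" where
  "components G = {{y \<in> verts G. joined G x y} | x. x \<in> verts G}"

definition isthmus :: "('v, 'e) pre_signed_graph \<Rightarrow> 'e \<Rightarrow> bool" where
  "isthmus G e \<longleftrightarrow> e \<in> edges G \<and> card (components G) < card (components (del_edge G e))"

definition sign_conn :: "('v, 'e) pre_signed_graph \<Rightarrow> 'v \<Rightarrow> 'v \<Rightarrow> bool" where
  "sign_conn G x y \<longleftrightarrow> x = y \<or>
     (\<exists>p. chain G x p y \<and> chain_sign G p = 1) \<and> (\<exists>p. chain G x p y \<and> chain_sign G p = -1)"

definition sign_connected :: "('v, 'e) pre_signed_graph \<Rightarrow> bool" where
  "sign_connected G \<longleftrightarrow> (\<forall>x\<in>verts G. \<forall>y\<in>verts G. sign_conn G x y)"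

definition sign_isthmus :: "('v, 'e) pre_signed_graph \<Rightarrow> 'e \<Rightarrow> bool" where
  "sign_isthmus G e \<longleftrightarrow> sign_connected G \<and> e \<in> edges G \<and> \<not> sign_connected (del_edge G e)"

end

theory Submission
  imports Defs
begin

text \<open>An edge \<open>f\<close> that lies on no cycle separates its endpoints, so the component of one endpoint
  in \<open>G - f\<close> is a cut crossed only by \<open>f\<close>, and every closed chain uses \<open>f\<close> an even number of
  times. Hence in a forest all closed chains are positive, which yields the forward direction of
  (a), and together with the cut also (b). Conversely, a negative cycle in a connected graph can be
  inserted into any chain, which makes the graph sign connected. For (c), two distinct cycles through \<open>e\<close>
  give a closed chain in \<open>G - e\<close> in which some edge occurs exactly once, so \<open>G - e\<close> still contains a
  cycle, and by (a) it is sign connected as soon as it is connected.\<close>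

text \<open>Turns the sign of a chain into a product of powers, with edge multiplicities as
  exponents, so that only their parity matters.\<close>

lemma prod_list_map_conv_count:
  fixes h :: "'a \<Rightarrow> 'b::comm_monoid_mult"
  shows "prod_list (map h xs) = (\<Prod>x\<in>set xs. h x ^ count_list xs x)"
proof (induction xs)
  case (Cons a xs)
  have "(\<Prod>x\<in>set xs. h x ^ count_list (a # xs) x)
      = (\<Prod>x\<in>set xs. (if x = a then h a else 1) * h x ^ count_list xs x)"
    by (rule prod.cong) auto
  also have "\<dots> = (if a \<in> set xs then h a else 1) * (\<Prod>x\<in>set xs. h x ^ count_list xs x)"
    by (simp add: prod.distrib)
  finally show ?case
    using Cons by (cases "a \<in> set xs") (simp_all add: insert_absorb del: count_list.simps(2), simp)
qed simp

lemma card_ge_2_imp_two_elements: "card A \<ge> 2 \<Longrightarrow> \<exists>x\<in>A. \<exists>y\<in>A. x \<noteq> y"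
  by (metis card_2_iff insert_subset obtain_subset_with_card_n)

lemma distinct_count_list: "distinct xs \<Longrightarrow> count_list xs x = (if x \<in> set xs then 1 else 0)"
  by (induction xs) auto

section \<open>Chains\<close>

lemma chain_verts: "chain G u p v \<Longrightarrow> u \<in> verts G \<and> v \<in> verts G"
  by (induction G u p v rule: chain.induct) auto

lemma chain_edges: "chain G u p v \<Longrightarrow> fst ` set p \<subseteq> edges G"
  by (induction G u p v rule: chain.induct) auto

lemma chain_append: "chain G u (p @ q) v \<longleftrightarrow> (\<exists>w. chain G u p w \<and> chain G w q v)"
proof (induction p arbitrary: u)
  case Nil
  then show ?case using chain_verts by fastforce
qed auto

text \<open>Each step stores its target, so reversing shifts the vertices by one place; only the
  edge sequence is literally reversed.\<close>

lemma chain_rev: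
  "chain G u p v \<Longrightarrow> \<exists>q. chain G v q u \<and> map fst q = rev (map fst p)"
proof (induction G u p v rule: chain.induct)
  case (1 G u v)
  then show ?case by (intro exI[of _ "[]"]) auto
next
  case (2 G u e w p v)
  then obtain q where q: "chain G v q w" "map fst q = rev (map fst p)" by auto
  have "chain G w [(e, u)] u" using 2(2) chain_verts[OF q(1)] by (auto simp: insert_commute)
  with q show ?case by (intro exI[of _ "q @ [(e, u)]"]) (auto simp: chain_append)
qed

lemma chain_del_edge:
  "chain (del_edge G f) u p v \<longleftrightarrow> chain G u p v \<and> f \<notin> fst ` set p"
proof (induction p arbitrary: u)
  case (Cons s p)
  obtain e w where "s = (e, w)" by (cases s)
  moreover have "ends (del_edge G f) = ends G" "edges (del_edge G f) = edges G - {f}"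
    "verts (del_edge G f) = verts G" by (simp_all add: del_edge_def)
  ultimately show ?case using Cons.IH[of w] by auto
qed (simp add: del_edge_def)

lemma verts_del_edge [simp]: "verts (del_edge G f) = verts G"
  by (simp add: del_edge_def)

lemma signed_graph_del_edge: "signed_graph G \<Longrightarrow> signed_graph (del_edge G f)"
  by (auto simp: signed_graph_def del_edge_def)

lemma cycles_del_edge: "cycles (del_edge G f) = {C \<in> cycles G. f \<notin> C}"
  unfolding cycles_def chain_del_edge by blast

lemma cycle_sign_del_edge [simp]: "cycle_sign (del_edge G f) C = cycle_sign G C"
  by (simp add: cycle_sign_def del_edge_def)

lemma joined_refl: "u \<in> verts G \<Longrightarrow> joined G u u"
  unfolding joined_def by (intro exI[of _ "[]"]) simp

lemma joined_sym: "joined G u v \<Longrightarrow> joined G v u"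
  unfolding joined_def using chain_rev by metis

lemma joined_trans: "joined G u v \<Longrightarrow> joined G v w \<Longrightarrow> joined G u w"
  unfolding joined_def using chain_append by metis

lemma joined_imp_path:
  assumes "joined G u v"
  obtains p where "chain G u p v" "distinct (u # map snd p)"
proof -
  have "\<exists>q. chain G u q v \<and> distinct (u # map snd q)" if "chain G u p v" for p
    using that
  proof (induction G u p v rule: chain.induct)
    case (1 G u v)
    then show ?case by (intro exI[of _ "[]"]) auto
  next
    case (2 G u e w p v)
    then obtain q where q: "chain G w q v" "distinct (w # map snd q)" by auto
    have eq: "chain G u ((e, w) # q) v" using 2(2) q by auto
    show ?case
    proof (cases "u \<in> set (map snd ((e, w) # q))")
      \<comment> \<open>The start \<open>u\<close> recurs on the path found for the rest, so
        everything up to that occurrence is cut off.\<close>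
      case True
      then obtain f where "(f, u) \<in> set ((e, w) # q)"
        by (metis imageE list.set_map prod.collapse)
      then obtain x y where xy: "(e, w) # q = x @ (f, u) # y" by (meson split_list)
      have "distinct (map snd (x @ (f, u) # y))" using q(2) unfolding xy[symmetric] by simp
      then have "distinct (u # map snd y)" by auto
      moreover have "chain G u y v" using eq unfolding xy chain_append by auto
      ultimately show ?thesis by blast
    next
      case False
      then show ?thesis using eq q(2) by (intro exI[of _ "(e, w) # q"]) auto
    qed
  qed
  then show ?thesis using assms that unfolding joined_def by blast
qed

lemma chain_ends_subset:
  "chain G u p v \<Longrightarrow> e \<in> fst ` set p \<Longrightarrow> ends G e \<subseteq> insert u (snd ` set p)"
proof (induction G u p v rule: chain.induct)
  case (2 G u d w p v)
  show ?case
  proof (cases "e = d")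
    case True
    then show ?thesis using 2(2) by simp
  next
    case False
    then have "e \<in> fst ` set p" using 2(3) by simp
    then have "ends G e \<subseteq> insert w (snd ` set p)" using 2(1,2) by simp
    then show ?thesis by auto
  qed
qed simp

text \<open>If the first edge recurred, its endpoint \<open>u\<close> would be among the later
  vertices, by \<open>chain_ends_subset\<close>.\<close>

lemma path_distinct_edges:
  "chain G u p v \<Longrightarrow> distinct (u # map snd p) \<Longrightarrow> distinct (map fst p)"
proof (induction G u p v rule: chain.induct)
  case (2 G u e w p v)
  have step: "ends G e = {u, w}" "chain G w p v" using 2(2) by simp_all
  have d: "u \<notin> insert w (snd ` set p)" "distinct (w # map snd p)" using 2(3) by simp_all
  have "e \<notin> fst ` set p"
  proof
    assume "e \<in> fst ` set p"
    from chain_ends_subset[OF step(2) this] show False using step(1) d(1) by blast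
  qed
  moreover have "distinct (map fst p)" by (rule 2(1)[OF step(2) d(2)])
  ultimately show ?case by simp
qed simp

section \<open>Cycles and cuts\<close>

lemma joined_del_edge_imp_cycle:
  assumes f: "f \<in> edges G" "ends G f = {a, b}" and ab: "joined (del_edge G f) a b"
  obtains C where "C \<in> cycles G" "f \<in> C"
proof -
  \<comment> \<open>A path is taken so that closing it with \<open>f\<close> repeats no vertex. If
    \<open>f\<close> is a loop, the path is empty and \<open>f\<close> alone is the cycle.\<close>
  obtain p where p: "chain (del_edge G f) a p b" "distinct (a # map snd p)"
    using joined_imp_path[OF ab] .
  have d: "distinct (map fst p)" using path_distinct_edges[OF p] .
  have fp: "f \<notin> fst ` set p" and c: "chain G a p b" using p(1) by (auto simp: chain_del_edge)
  have "chain G a (p @ [(f, a)]) a"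
    using c f chain_verts[OF c] by (auto simp: chain_append insert_commute)
  moreover have "distinct (map fst (p @ [(f, a)]))" "distinct (map snd (p @ [(f, a)]))"
    using d fp p(2) by auto
  ultimately have "fst ` set (p @ [(f, a)]) \<in> cycles G"
    unfolding cycles_def by blast
  then show ?thesis by (rule that) simp
qed

lemma even_count_closed_chain:
  assumes G: "signed_graph G" and f: "\<And>C. C \<in> cycles G \<Longrightarrow> f \<notin> C" and p: "chain G u p u"
  shows "even (count_list (map fst p) f)"
proof (cases "f \<in> edges G")
  case False
  then have "f \<notin> set (map fst p)" using chain_edges[OF p] by auto
  from count_notin[OF this] show ?thesis by simp
next
  case True
  then obtain a b where ab: "ends G f = {a, b}" "a \<in> verts G" "b \<in> verts G"
    using G unfolding signed_graph_def by blast
  \<comment> \<open>\<open>g\<close> marks one side of the cut. The other end \<open>b\<close> is on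
    the opposite side, as \<open>f\<close> would otherwise close a cycle; in particular
    \<open>f\<close> is no loop.\<close>
  define g where "g v = joined (del_edge G f) a v" for v
  have nb: "\<not> g b" unfolding g_def using joined_del_edge_imp_cycle[OF True ab(1)] f by blast
  have ga: "g a" unfolding g_def using ab by (simp add: joined_refl)
  \<comment> \<open>Generalized to open chains for the induction: each use of \<open>f\<close>
    switches sides, and any other step stays on its side.\<close>
  have "even (count_list (map fst p) f) \<longleftrightarrow> (g u \<longleftrightarrow> g v)" if "chain G u p v" for u p v
    using that
  proof (induction p arbitrary: u)
    case (Cons s p)
    obtain e w where s: "s = (e, w)" by (cases s)
    have p: "chain G w p v" using Cons.prems s by simp
    have step: "ends G e = {u, w}" "chain G u [(e, w)] w"
      using Cons.prems chain_verts[OF p] s by auto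
    have IH: "even (count_list (map fst p) f) \<longleftrightarrow> (g w \<longleftrightarrow> g v)" using Cons.IH p .
    show ?case
    proof (cases "e = f")
      case True
      then have "g u \<noteq> g w" using step(1) ab(1) ga nb by (auto simp: doubleton_eq_iff)
      then show ?thesis using IH True s by auto
    next
      case False
      then have "joined (del_edge G f) u w"
        unfolding joined_def using step(2) chain_del_edge[of G f] by fastforce
      then have "g u = g w" unfolding g_def by (meson joined_sym joined_trans)
      then show ?thesis using IH False s by auto
    qed
  qed simp
  from this[OF p] show ?thesis by simp
qed

lemma chain_sign_conv: "chain_sign G p = prod_list (map (esign G) (map fst p))"
  by (simp add: chain_sign_def o_def case_prod_unfold)

lemma chain_sign_append [simp]: "chain_sign G (p @ q) = chain_sign G p * chain_sign G q"
  by (simp add: chain_sign_def)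

lemma chain_rev_sign:
  assumes "chain G u p v"
  obtains q where "chain G v q u" "chain_sign G q = chain_sign G p"
proof -
  obtain q where q: "chain G v q u" "map fst q = rev (map fst p)" using chain_rev[OF assms] by blast
  have "prod_list (rev xs) = prod_list xs" for xs :: "int list"
    by (induction xs) (auto simp: mult.commute)
  then have "chain_sign G q = chain_sign G p"
    unfolding chain_sign_conv q(2) by (simp only: rev_map[symmetric])
  with q(1) that show ?thesis by blast
qed

lemma chain_sign_values:
  "signed_graph G \<Longrightarrow> chain G u p v \<Longrightarrow> chain_sign G p = 1 \<or> chain_sign G p = -1"
  by (induction G u p v rule: chain.induct)
    (auto simp: chain_sign_def signed_graph_def)

lemma forest_closed_chain_sign:
  assumes G: "signed_graph G" "cycles G = {}" and p: "chain G u p u"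
  shows "chain_sign G p = 1"
proof -
  have "esign G e ^ count_list (map fst p) e = 1" if "e \<in> set (map fst p)" for e
  proof -
    have "e \<in> edges G" using that chain_edges[OF p] by auto
    then have "esign G e = 1 \<or> esign G e = -1" using G(1) unfolding signed_graph_def by blast
    moreover have "even (count_list (map fst p) e)"
      using even_count_closed_chain[OF G(1) _ p] G(2) by blast
    ultimately show ?thesis by auto
  qed
  then show ?thesis unfolding chain_sign_conv prod_list_map_conv_count by simp
qed

text \<open>Two chains of opposite sign between distinct vertices would combine into a negative
  closed chain. Two vertices are required because \<open>sign_conn\<close> is reflexive by
  definition.\<close>

lemma forest_not_sign_connected:
  assumes G: "signed_graph G" "cycles G = {}" and V: "card (verts G) \<ge> 2"
  shows "\<not> sign_connected G"
proof
  assume sc: "sign_connected G"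
  obtain x y where xy: "x \<in> verts G" "y \<in> verts G" "x \<noteq> y"
    using V card_ge_2_imp_two_elements by metis
  then obtain p q where p: "chain G x p y" "chain_sign G p = 1"
    and q: "chain G x q y" "chain_sign G q = -1"
    using sc unfolding sign_connected_def sign_conn_def by blast
  obtain r where r: "chain G y r x" "chain_sign G r = -1"
    using chain_rev_sign[OF q(1)] q(2) by metis
  have "chain G x (p @ r) x" using p(1) r(1) chain_append by metis
  from forest_closed_chain_sign[OF G this] show False using p r by simp
qed

text \<open>Rotate the closed chain to start just after its step along \<open>e\<close>. The
  remainder \<open>y @ x\<close> avoids \<open>e\<close> because the edges are distinct.\<close>

lemma cycle_through_edge:
  assumes "C \<in> cycles G" "e \<in> C"
  obtains a b p where "ends G e = {a, b}" "chain (del_edge G e) a p b"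
    "distinct (map fst p)" "C = insert e (fst ` set p)"
proof -
  obtain u q where q: "chain G u q u" "distinct (map fst q)" "C = fst ` set q"
    using assms(1) unfolding cycles_def by blast
  then obtain w where "(e, w) \<in> set q" using assms(2) by auto
  then obtain x y where xy: "q = x @ (e, w) # y" by (meson split_list)
  obtain b where b: "chain G u x b" "ends G e = {b, w}" "chain G w y u"
    using q(1) unfolding xy chain_append by auto
  show thesis
  proof
    show "ends G e = {w, b}" using b(2) by auto
    have "chain G w (y @ x) b" using b chain_append by metis
    then show "chain (del_edge G e) w (y @ x) b"
      using q(2) xy by (auto simp: chain_del_edge)
    show "distinct (map fst (y @ x))" using q(2) xy by auto
    show "C = insert e (fst ` set (y @ x))" using q(3) xy by auto
  qed
qed

lemma cycle_elimination:
  assumes G: "signed_graph G" and C: "C \<in> cycles G" "D \<in> cycles G" "C \<noteq> D"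
  obtains E where "E \<in> cycles G" "e \<notin> E"
proof (rule ccontr)
  assume "\<not> thesis"
  then have all: "\<And>E. E \<in> cycles G \<Longrightarrow> e \<in> E" using that by blast
  then have acyc: "cycles (del_edge G e) = {}" by (auto simp: cycles_del_edge)
  obtain a b p where p: "ends G e = {a, b}" "chain (del_edge G e) a p b"
    "distinct (map fst p)" "C = insert e (fst ` set p)"
    using cycle_through_edge[OF C(1) all[OF C(1)]] .
  obtain c d q where q: "ends G e = {c, d}" "chain (del_edge G e) c q d"
    "distinct (map fst q)" "D = insert e (fst ` set q)"
    using cycle_through_edge[OF C(2) all[OF C(2)]] .
  \<comment> \<open>The ends of \<open>e\<close> form an unordered pair, so the chain obtained from
    \<open>D\<close> may have to be reversed before it can be joined to \<open>p\<close>.\<close>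
  obtain r where r: "chain (del_edge G e) b r a" "distinct (map fst r)"
    "fst ` set r = fst ` set q"
  proof (cases "c = b \<and> d = a")
    case True
    then show ?thesis using q that by blast
  next
    case False
    then have "c = a" "d = b" using p(1) q(1) by (auto simp: doubleton_eq_iff)
    then obtain r where "chain (del_edge G e) b r a" and r: "map fst r = rev (map fst q)"
      using chain_rev q(2) by metis
    moreover have "fst ` set r = fst ` set q" using arg_cong[OF r, of set] by simp
    moreover have "distinct (map fst r)" unfolding r using q(3) by simp
    ultimately show ?thesis using that by blast
  qed
  have closed: "chain (del_edge G e) a (p @ r) a" using p(2) r(1) chain_append by metis
  \<comment> \<open>Each of \<open>p\<close> and \<open>r\<close> contains \<open>f\<close> at most
    once and the total is even, so both contain it or neither does. Hence \<open>C\<close> and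
    \<open>D\<close> would coincide.\<close>
  have "f \<in> set (map fst p) \<longleftrightarrow> f \<in> set (map fst r)" for f
  proof -
    have "even (count_list (map fst (p @ r)) f)"
      using even_count_closed_chain[OF signed_graph_del_edge[OF G] _ closed] acyc by blast
    moreover have "count_list (map fst p) f = (if f \<in> set (map fst p) then 1 else 0)"
      "count_list (map fst r) f = (if f \<in> set (map fst r) then 1 else 0)"
      using p(3) r(2) by (simp_all only: distinct_count_list)
    ultimately show ?thesis by (auto split: if_splits)
  qed
  then have "fst ` set p = fst ` set r" by (metis set_map subsetI subset_antisym)
  with p(4) q(4) r(3) C(3) show False by simp
qed

section \<open>Sign connectivity\<close>

lemma sign_connected_imp_connected:
  "sign_connected G \<Longrightarrow> verts G \<noteq> {} \<Longrightarrow> connected_graph G"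
  unfolding sign_connected_def sign_conn_def connected_graph_def
  by (metis joined_def joined_refl)

lemma connected_negative_cycle_imp_sign_connected:
  assumes G: "signed_graph G" "connected_graph G" and C: "C \<in> cycles G" "cycle_sign G C \<noteq> 1"
  shows "sign_connected G"
  unfolding sign_connected_def sign_conn_def
\<comment> \<open>Chains of both signs are found even when \<open>x = y\<close>.\<close>
proof (intro ballI disjI2)
  fix x y assume xy: "x \<in> verts G" "y \<in> verts G"
  obtain u c where c: "chain G u c u" "distinct (map fst c)" "C = fst ` set c"
    using C(1) unfolding cycles_def by blast
  \<comment> \<open>The product over the edge set equals the product along the list because the
    edges of \<open>c\<close> are distinct.\<close>
  have "cycle_sign G C = chain_sign G c"
    unfolding cycle_sign_def chain_sign_conv c(3)
    using prod.distinct_set_conv_list[OF c(2), of "esign G"] by simp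
  then have neg: "chain_sign G c = -1" using C(2) chain_sign_values[OF G(1) c(1)] by auto
  have "u \<in> verts G" using chain_verts[OF c(1)] by simp
  then obtain p q where p: "chain G x p u" and q: "chain G u q y"
    using G(2) xy unfolding connected_graph_def joined_def by blast
  \<comment> \<open>Pass through a vertex \<open>u\<close> of the cycle, once without and once with
    a turn around it; the two signs are opposite.\<close>
  have pq: "chain G x (p @ q) y" and pcq: "chain G x (p @ c @ q) y"
    using p q c(1) chain_append by metis+
  have "chain_sign G (p @ c @ q) = - chain_sign G (p @ q)" using neg by simp
  then show "(\<exists>p. chain G x p y \<and> chain_sign G p = 1) \<and> (\<exists>p. chain G x p y \<and> chain_sign G p = -1)"
    using pq pcq chain_sign_values[OF G(1) pq] by (metis add.inverse_inverse)
qed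

text \<open>Links the component count in \<open>isthmus\<close> to connectivity. Finiteness is
  essential, since \<open>card\<close> of an infinite set is 0.\<close>

lemma connected_iff_card_components:
  assumes "finite (verts G)" "verts G \<noteq> {}"
  shows "connected_graph G \<longleftrightarrow> card (components G) \<le> 1"
proof
  assume "connected_graph G"
  then have "components G \<subseteq> {verts G}"
    unfolding connected_graph_def components_def by blast
  then show "card (components G) \<le> 1" using card_mono[of "{verts G}"] by fastforce
next
  assume le: "card (components G) \<le> 1"
  have "components G = (\<lambda>x. {y \<in> verts G. joined G x y}) ` verts G"
    unfolding components_def by blast
  then have "finite (components G)" using assms(1) by simp
  then have eq: "\<And>A B. A \<in> components G \<Longrightarrow> B \<in> components G \<Longrightarrow> A = B"
    using le by (simp add: card_le_Suc0_iff_eq)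
  have "joined G x y" if xy: "x \<in> verts G" "y \<in> verts G" for x y
  proof -
    have "{z \<in> verts G. joined G x z} = {z \<in> verts G. joined G y z}"
      using xy by (intro eq) (auto simp: components_def)
    then show ?thesis using xy joined_refl by fastforce
  qed
  then show "connected_graph G" using assms(2) unfolding connected_graph_def by blast
qed

lemma isthmus_iff_disconnecting:
  assumes G: "signed_graph G" "connected_graph G" and e: "e \<in> edges G"
  shows "isthmus G e \<longleftrightarrow> \<not> connected_graph (del_edge G e)"
proof -
  have V: "finite (verts G)" "verts G \<noteq> {}"
    using G unfolding signed_graph_def connected_graph_def by auto
  have "components G = {verts G}"
    using G(2) unfolding connected_graph_def components_def by blast
  then have "card (components G) = 1" by simp
  then show ?thesis using connected_iff_card_components[of "del_edge G e"] V e
    unfolding isthmus_def by auto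
qed

theorem theorem5p4:
  fixes G :: "('v, 'e) pre_signed_graph"
  assumes "signed_graph G"
    and "connected_graph G"
    and "\<not> (\<exists>C\<in>cycles G. cycle_sign G C = 1)"
    and "card (verts G) \<ge> 2"
  shows "(sign_connected G \<longleftrightarrow> cycles G \<noteq> {}) \<and>
         (card (cycles G) = 1 \<longrightarrow> (\<forall>e\<in>edges G. sign_isthmus G e)) \<and>
         (card (cycles G) \<ge> 2 \<longrightarrow> (\<forall>e\<in>edges G. sign_isthmus G e \<longleftrightarrow> isthmus G e))"
proof (intro conjI impI ballI)
  have nonempty: "verts G \<noteq> {}" using assms(2) unfolding connected_graph_def by simp
  \<comment> \<open>The criterion of (a) for \<open>G\<close> and all its edge deletions at once:
    deletion creates no cycle, so none is positive, but connectivity may be lost and becomes a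
    conjunct.\<close>
  have sc_cycle: "sign_connected H \<longleftrightarrow> connected_graph H \<and> cycles H \<noteq> {}"
    if "H = G \<or> H = del_edge G e" for H e
  proof
    have H: "signed_graph H" "card (verts H) \<ge> 2" "verts H \<noteq> {}"
      using that assms(1,4) nonempty signed_graph_del_edge[OF assms(1)] by auto
    show "sign_connected H \<Longrightarrow> connected_graph H \<and> cycles H \<noteq> {}"
      using H forest_not_sign_connected sign_connected_imp_connected by blast
    have "\<forall>C\<in>cycles H. cycle_sign H C \<noteq> 1"
      using that assms(3) by (auto simp: cycles_del_edge)
    then show "connected_graph H \<and> cycles H \<noteq> {} \<Longrightarrow> sign_connected H"
      using H(1) connected_negative_cycle_imp_sign_connected by blast
  qed
  show a: "sign_connected G \<longleftrightarrow> cycles G \<noteq> {}" using sc_cycle assms(2) by blast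
  {
    fix e assume one: "card (cycles G) = 1" and e: "e \<in> edges G"
    obtain C where C: "cycles G = {C}" using one by (rule card_1_singletonE)
    \<comment> \<open>If the ends of \<open>e\<close> were still joined after its deletion,
      \<open>e\<close> would lie on a cycle, which could only be \<open>C\<close>.\<close>
    have "\<not> connected_graph (del_edge G e)" if "e \<notin> C"
    proof
      assume con: "connected_graph (del_edge G e)"
      obtain x y where xy: "ends G e = {x, y}" "x \<in> verts G" "y \<in> verts G"
        using assms(1) e unfolding signed_graph_def by blast
      then have "joined (del_edge G e) x y" using con unfolding connected_graph_def by simp
      then show False using joined_del_edge_imp_cycle[OF e xy(1)] C that by blast
    qed
    moreover have "cycles (del_edge G e) = {}" if "e \<in> C"
      using C that by (auto simp: cycles_del_edge)
    ultimately show "sign_isthmus G e"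
      unfolding sign_isthmus_def using a C e sc_cycle by blast
  }
  {
    fix e assume two: "card (cycles G) \<ge> 2" and e: "e \<in> edges G"
    obtain C D where CD: "C \<in> cycles G" "D \<in> cycles G" "C \<noteq> D"
      using two card_ge_2_imp_two_elements by metis
    \<comment> \<open>The cycle \<open>E\<close> survives the deletion of \<open>e\<close>, so by
      \<open>sc_cycle\<close> only connectivity decides whether sign connectivity is lost.\<close>
    obtain E where "E \<in> cycles G" "e \<notin> E" using cycle_elimination[OF assms(1) CD] .
    then have "cycles (del_edge G e) \<noteq> {}" by (auto simp: cycles_del_edge)
    then show "sign_isthmus G e \<longleftrightarrow> isthmus G e"
      unfolding sign_isthmus_def isthmus_iff_disconnecting[OF assms(1,2) e]
      using a CD e sc_cycle by blast
  }
qed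

end
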